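(* Let $n,M\in\mathbb{N}$, $n_*=M(n+2)$, $P=\mathbb{R}^{M}\times\mathbb{R}^{n\times M}\times\mathbb{R}^{M}\cong\mathbb{R}^{n_*}$, $X=L^2([0,1]^n)$, and let $Y$ be a Hilbert space. Let $F:X\to Y$ be a linear, bounded operator with trivial nullspace and dense range. Let $\sigma:\mathbb{R}\to\mathbb{R}^+$ be strictly monotonic (like sigmoid or hyperbolic tangent) and two times differentiable with uniformly bounded function values and first and second order derivatives, and let $\Psi$ be the shallow neural network operator generated by $\sigma$, $$\Psi(\alpha,w,\theta)(x)=\sum_{j=1}^{M}\alpha_j\,\sigma\bigl(w_j^T x+\theta_j\bigr),\qquad x\in[0,1]^n .$$ Let $\mathcal{D}(\Psi)\subseteq P$ be a maximal set of vectors $p=(\alpha,w,\theta)$ such that the $n_*$ functions of $x$ $$\frac{\partial\Psi}{\partial\alpha_s}[p],\quad\frac{\partial\Psi}{\partial w_s^t}[p],\quad\frac{\partial\Psi}{\partial\theta_s}[p],\qquad s=1,\dots,M,\ t=1,\dots,n,$$ are linearly independent, and assume (as a conjecture) that $\mathcal{D}(\Psi)$ is open and dense in $X=L^2([0,1]^n)$. Put $N=F\circ\Psi$ with $\Psi:\mathcal{D}(\Psi)\to X$, so that $\mathcal{D}(N)=\mathcal{D}(\Psi)$, and let $y\in Y$. Let $p^0\in\mathcal{D}(\Psi)$ be the starting point of the Gauss-Newton iteration $$p^{k+1}=p^k-N'(p^k)^\dagger\bigl(N(p^k)-y\bigr),\qquad k\in\mathbb{N}_0,$$ and let $p^\dagger\in\mathcal{D}(\Psi)$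 be a solution of $N(p^\dagger)=y$, which satisfy $$\overline{\mathcal{B}(p^0;\rho)}\subseteq\mathcal{D}(N)\quad\text{with}\quad\rho:=\|p^\dagger-p^0\|_P,\qquad\text{and}\qquad h:=\frac{\rho\,C_IC_L}{2}<1,$$ with the constants $C_I,C_L$ given in the context. Then the Gauss-Newton iterates converge to $p^\dagger$ locally (that is, if $p^0$ is sufficiently close to $p^\dagger$) and quadratically.
   Context: $\mathcal{B}(p;\rho)$ is the ball in $P$ with center $p$ and radius $\rho$, and the overline denotes closure. In $p=(\alpha,w,\theta)$ we have $\alpha_j,\theta_j\in\mathbb{R}$ and $w_j=(w_j^1,\dots,w_j^n)\in\mathbb{R}^n$ for $j=1,\dots,M$. The sigmoid function is $t\mapsto 1/(1+e^{-t/\varepsilon})$ with a parameter $\varepsilon>0$. The notation $\frac{\partial\Psi}{\partial\alpha_s}[p]$ etc. denotes the partial derivative of $\Psi$ with respect to the indicated parameter, evaluated at $p$; it is a function of $x$, viewed as an element of $L^2([0,1]^n)$. The Fréchet-derivative of $\Psi$ with respect to all parameters is $\Psi'(p)q=\sum_{i=1}^{n_*}q_i\,\partial_{p_i}\Psi(p)$. The constants $C_I,C_L$ are those expressing local boundedness and local Lipschitz-continuity of $\Psi'$ in $\mathcal{D}(\Psi)$, that is, $$\|\Psi'(p)-\Psi'(q)\|_{P\to X}\le C_L\|p-q\|_P,\qquad\|\Psi'(p)\|_{P\to X}\le C_I\qquad\text{for }p,q\in\mathcal{D}(\Psi).$$ For $p\in\mathcal{D}(\Psi)$ let $X_p:=\mathrm{span}\{\partial_{p_i}\Psi(p):i=1,\dots,n_*\}$,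 and define $\Psi'(p)^{-1}:X_p\to P$ by $\sum_i x_i\,\partial_{p_i}\Psi(p)\mapsto(x_i)_{i=1}^{n_*}$. Define $\Psi'(p)^\dagger:X\to P$ by $\Psi'(p)^\dagger x:=\Psi'(p)^{-1}x_1$, where $x=x_1+x_2$ with $x_1\in X_p$, $x_2\in X_p^\perp$. The generalized inverse $N'(p)^\dagger$ of $N'(p)=F\Psi'(p)$ is the operator $N'(p)^\dagger z=\Psi'(p)^\dagger F^{-1}z$ for $z\in\mathcal{R}(F)$, the range of $F$, where $F^{-1}:\mathcal{R}(F)\to X$. Quadratic convergence of $p^k$ to $p^\dagger$ means $p^k\to p^\dagger$ and there is $C\ge 0$ with $\|p^{k+1}-p^\dagger\|_P\le C\|p^k-p^\dagger\|_P^2$ for all $k$.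
   Formalization: The assumption that D(Ψ) is open and dense in X=L² is ill-defined, since D(Ψ) is a subset of P; it is read as open and dense in P. The bounds with C_I, C_L are required only on the closed ball around p⁰, as uniform bounds on a dense D(Ψ) cannot hold. *)

theory Defs
  imports "HOL-Analysis.Analysis"
begin

section \<open>The space $L^2([0,1]^n)$\<close>

definition unit_cube :: "(real^'n::finite) set" where
  "unit_cube = cbox 0 1"

abbreviation cube_measure :: "(real^'n::finite) measure" where
  "cube_measure \<equiv> lebesgue_on unit_cube"

definition square_integrable :: "(real^'n::finite \<Rightarrow> real) \<Rightarrow> bool" where
  "square_integrable f \<longleftrightarrow>
     f \<in> borel_measurable cube_measure \<and> integrable cube_measure (\<lambda>x. (f x)\<^sup>2)"

definition L2_eq :: "(real^'n::finite \<Rightarrow> real) \<Rightarrow> (real^'n \<Rightarrow> real) \<Rightarrow> bool" where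
  "L2_eq f g \<longleftrightarrow>
     square_integrable f \<and> square_integrable g \<and> (AE x in cube_measure. f x = g x)"

lemma square_integrable_zero: "square_integrable (\<lambda>_. 0)"
  by (simp add: square_integrable_def)

lemma square_integrable_product:
  assumes "square_integrable f" "square_integrable g"
  shows "integrable cube_measure (\<lambda>x. f x * g x)"
proof (rule Bochner_Integration.integrable_bound)
  show "integrable cube_measure (\<lambda>x. (f x)\<^sup>2 + (g x)\<^sup>2)"
    using assms by (auto simp: square_integrable_def)
  show "(\<lambda>x. f x * g x) \<in> borel_measurable cube_measure"
    using assms by (auto simp: square_integrable_def)
  have "\<bar>a * b\<bar> \<le> a\<^sup>2 + b\<^sup>2" for a b :: real
  proof -
    have "0 \<le> (\<bar>a\<bar> - \<bar>b\<bar>)\<^sup>2" by simp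
    then have "2 * (\<bar>a\<bar> * \<bar>b\<bar>) \<le> a\<^sup>2 + b\<^sup>2" by (simp add: power2_diff)
    moreover have "0 \<le> \<bar>a\<bar> * \<bar>b\<bar>" by simp
    ultimately show ?thesis unfolding abs_mult by linarith
  qed
  then show "AE x in cube_measure. norm (f x * g x) \<le> norm ((f x)\<^sup>2 + (g x)\<^sup>2)"
    by auto
qed

lemma square_integrable_add:
  assumes "square_integrable f" "square_integrable g"
  shows "square_integrable (\<lambda>x. f x + g x)"
proof -
  have "integrable cube_measure (\<lambda>x. (f x)\<^sup>2 + (g x)\<^sup>2 + 2 * (f x * g x))"
    using assms square_integrable_product[OF assms]
    by (intro Bochner_Integration.integrable_add integrable_mult_right)
      (auto simp: square_integrable_def)
  then show ?thesis
    using assms by (auto simp: square_integrable_def power2_sum mult.assoc)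
qed

lemma square_integrable_scale:
  "square_integrable f \<Longrightarrow> square_integrable (\<lambda>x. c * f x)"
  by (auto simp: square_integrable_def power_mult_distrib)

lemma square_integrable_uminus:
  "square_integrable f \<Longrightarrow> square_integrable (\<lambda>x. - f x)"
  using square_integrable_scale[of f "- 1"] by simp

lemma square_integrable_diff:
  assumes "square_integrable f" "square_integrable g"
  shows "square_integrable (\<lambda>x. f x - g x)"
  using square_integrable_add[OF assms(1) square_integrable_uminus[OF assms(2)]] by simp

lemma square_integrable_continuous:
  assumes "continuous_on UNIV f"
  shows "square_integrable f"
proof -
  have c: "continuous_on unit_cube f" "continuous_on unit_cube (\<lambda>x. (f x)\<^sup>2)"
    using assms by (auto intro!: continuous_intros intro: continuous_on_subset)
  have "set_integrable lebesgue unit_cube (\<lambda>x. (f x)\<^sup>2)"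
    using c(2) absolutely_integrable_continuous[of 0 1 "\<lambda>x. (f x)\<^sup>2"] unfolding unit_cube_def by simp
  then have "integrable cube_measure (\<lambda>x. (f x)\<^sup>2)"
    by (subst integrable_restrict_space)
      (auto simp: set_integrable_def unit_cube_def)
  moreover have "f \<in> borel_measurable cube_measure"
    using c(1) by (auto simp: unit_cube_def intro: continuous_imp_measurable_on_sets_lebesgue)
  ultimately show ?thesis by (simp add: square_integrable_def)
qed

quotient_type 'n L2_cube = "real^'n::finite \<Rightarrow> real" / partial: L2_eq
  morphisms rep_L2 to_L2
proof (rule part_equivpI)
  show "\<exists>f::real^'n \<Rightarrow> real. L2_eq f f"
    using square_integrable_zero by (auto simp: L2_eq_def)
  show "symp (L2_eq :: (real^'n \<Rightarrow> real) \<Rightarrow> _)"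
    by (auto simp: symp_def L2_eq_def elim: eventually_mono)
  show "transp (L2_eq :: (real^'n \<Rightarrow> real) \<Rightarrow> _)"
    unfolding transp_def L2_eq_def by (auto elim: eventually_elim2)
qed

instantiation L2_cube :: (finite) real_vector
begin

lift_definition zero_L2_cube :: "'a L2_cube" is "\<lambda>_. 0"
  by (simp add: L2_eq_def square_integrable_zero)

lift_definition plus_L2_cube :: "'a L2_cube \<Rightarrow> 'a L2_cube \<Rightarrow> 'a L2_cube"
  is "\<lambda>f g x. f x + g x"
  unfolding L2_eq_def by (auto intro: square_integrable_add elim: eventually_elim2)

lift_definition uminus_L2_cube :: "'a L2_cube \<Rightarrow> 'a L2_cube"
  is "\<lambda>f x. - f x"
  unfolding L2_eq_def by (auto intro: square_integrable_uminus elim: eventually_mono)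

lift_definition minus_L2_cube :: "'a L2_cube \<Rightarrow> 'a L2_cube \<Rightarrow> 'a L2_cube"
  is "\<lambda>f g x. f x - g x"
  unfolding L2_eq_def by (auto intro: square_integrable_diff elim: eventually_elim2)

lift_definition scaleR_L2_cube :: "real \<Rightarrow> 'a L2_cube \<Rightarrow> 'a L2_cube"
  is "\<lambda>c f x. c * f x"
  unfolding L2_eq_def by (auto intro: square_integrable_scale elim: eventually_mono)

instance
proof
  fix f g h :: "'a L2_cube" and a b :: real
  show "f + g + h = f + (g + h)"
    by transfer (auto simp: L2_eq_def add.assoc intro!: square_integrable_add)
  show "f + g = g + f"
    by transfer (auto simp: L2_eq_def add.commute intro!: square_integrable_add)
  show "0 + f = f"
    by transfer (auto simp: L2_eq_def)
  show "- f + f = 0"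
    by transfer (auto simp: L2_eq_def square_integrable_zero)
  show "f - g = f + - g"
    by transfer (auto simp: L2_eq_def intro: square_integrable_diff)
  show "a *\<^sub>R (f + g) = a *\<^sub>R f + a *\<^sub>R g"
    by transfer (auto simp: L2_eq_def distrib_left
        intro!: square_integrable_add square_integrable_scale)
  show "(a + b) *\<^sub>R f = a *\<^sub>R f + b *\<^sub>R f"
    by transfer (auto simp: L2_eq_def distrib_right
        intro!: square_integrable_add square_integrable_scale)
  show "a *\<^sub>R b *\<^sub>R f = (a * b) *\<^sub>R f"
    by transfer (auto simp: L2_eq_def mult.assoc intro!: square_integrable_scale)
  show "1 *\<^sub>R f = f"
    by transfer (auto simp: L2_eq_def)
qed

end

lift_definition L2_inner :: "'n::finite L2_cube \<Rightarrow> 'n L2_cube \<Rightarrow> real"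
  is "\<lambda>f g. integral\<^sup>L cube_measure (\<lambda>x. f x * g x)"
proof -
  fix f f' g g' :: "real^'n \<Rightarrow> real"
  assume "L2_eq f f'" "L2_eq g g'"
  moreover from this have "AE x in cube_measure. f x * g x = f' x * g' x"
    unfolding L2_eq_def by (auto elim: eventually_elim2)
  ultimately show "integral\<^sup>L cube_measure (\<lambda>x. f x * g x) = integral\<^sup>L cube_measure (\<lambda>x. f' x * g' x)"
    unfolding L2_eq_def
    by (intro integral_cong_AE) (auto simp: square_integrable_def)
qed

instantiation L2_cube :: (finite) real_inner
begin

definition inner_L2_cube :: "'a L2_cube \<Rightarrow> 'a L2_cube \<Rightarrow> real" where
  "inner_L2_cube = L2_inner"

definition norm_L2_cube :: "'a L2_cube \<Rightarrow> real" where
  "norm_L2_cube f = sqrt (f \<bullet> f)"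

definition dist_L2_cube :: "'a L2_cube \<Rightarrow> 'a L2_cube \<Rightarrow> real" where
  "dist_L2_cube f g = norm (f - g)"

definition uniformity_L2_cube :: "('a L2_cube \<times> 'a L2_cube) filter" where
  "uniformity_L2_cube = (INF e\<in>{0<..}. principal {(x, y). dist x y < e})"

definition sgn_L2_cube :: "'a L2_cube \<Rightarrow> 'a L2_cube" where
  "sgn_L2_cube f = f /\<^sub>R norm f"

definition open_L2_cube :: "'a L2_cube set \<Rightarrow> bool" where
  "open_L2_cube U \<longleftrightarrow> (\<forall>x\<in>U. eventually (\<lambda>(x', y). x' = x \<longrightarrow> y \<in> U) uniformity)"

instance
proof
  fix f g h :: "'a L2_cube" and a :: real and U :: "'a L2_cube set"
  show "sgn f = f /\<^sub>R norm f"
    by (rule sgn_L2_cube_def)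
  show "dist f g = norm (f - g)"
    by (rule dist_L2_cube_def)
  show "(uniformity :: ('a L2_cube \<times> 'a L2_cube) filter)
          = (INF e\<in>{0<..}. principal {(x, y). dist x y < e})"
    by (rule uniformity_L2_cube_def)
  show "open U = (\<forall>x\<in>U. eventually (\<lambda>(x', y). x' = x \<longrightarrow> y \<in> U) uniformity)"
    by (rule open_L2_cube_def)
  show "f \<bullet> g = g \<bullet> f"
    unfolding inner_L2_cube_def by transfer (simp add: mult.commute)
  show "(f + g) \<bullet> h = f \<bullet> h + g \<bullet> h"
    unfolding inner_L2_cube_def
    by transfer (simp add: L2_eq_def distrib_right square_integrable_product)
  show "(a *\<^sub>R f) \<bullet> g = a * (f \<bullet> g)"
    unfolding inner_L2_cube_def by transfer (simp add: mult.assoc)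
  show "0 \<le> f \<bullet> f"
    unfolding inner_L2_cube_def by transfer simp
  show "f \<bullet> f = 0 \<longleftrightarrow> f = 0"
    unfolding inner_L2_cube_def
  proof transfer
    fix f :: "real^'a \<Rightarrow> real"
    assume "L2_eq f f"
    then have f: "square_integrable f" by (simp add: L2_eq_def)
    have "integral\<^sup>L cube_measure (\<lambda>x. f x * f x) = 0
            \<longleftrightarrow> (AE x in cube_measure. f x * f x = 0)"
      by (rule integral_nonneg_eq_0_iff_AE) (auto intro: square_integrable_product f)
    then show "integral\<^sup>L cube_measure (\<lambda>x. f x * f x) = 0 \<longleftrightarrow> L2_eq f (\<lambda>_. 0)"
      using f by (simp add: L2_eq_def square_integrable_zero)
  qed
  show "norm f = sqrt (f \<bullet> f)"
    by (rule norm_L2_cube_def)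
qed

end


section \<open>Shallow neural networks\<close>

text \<open>
  Parameters \<open>(\<alpha>, w, \<theta>)\<close>, where \<open>M = CARD('m)\<close> and \<open>n = CARD('n)\<close>. The type is a
  Euclidean space of dimension \<open>M * (n + 2)\<close> with the Euclidean norm, and its \<^const>\<open>Basis\<close>
  consists of the coordinate unit vectors for the scalar parameters \<open>\<alpha>\<^sub>s\<close>, \<open>w\<^sub>s\<^sup>t\<close>
  and \<open>\<theta>\<^sub>s\<close>. The set \<^const>\<open>Basis\<close> therefore serves as the index set of the parameters, and
  \<open>q \<bullet> i\<close> is the \<open>i\<close>-th component of \<open>q\<close>.
\<close>

type_synonym ('m, 'n) params = "(real^'m) \<times> ((real^'n)^'m) \<times> (real^'m)"

definition net_fun ::
    "(real \<Rightarrow> real) \<Rightarrow> ('m::finite, 'n::finite) params \<Rightarrow> real^'n \<Rightarrow> real" where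
  "net_fun \<sigma> = (\<lambda>(\<alpha>, w, \<theta>) x. \<Sum>j\<in>UNIV. \<alpha> $ j * \<sigma> (w $ j \<bullet> x + \<theta> $ j))"

definition net ::
    "(real \<Rightarrow> real) \<Rightarrow> ('m::finite, 'n::finite) params \<Rightarrow> 'n L2_cube" where
  "net \<sigma> p = to_L2 (net_fun \<sigma> p)"

text \<open>For \<open>i \<in> Basis\<close>: the partial derivative of \<open>\<Psi>\<close> with respect to the \<open>i\<close>-th parameter,
  formed for each fixed \<open>x\<close> and then regarded as an element of $L^2$.\<close>

definition net_partial_fun ::
    "(real \<Rightarrow> real) \<Rightarrow> ('m::finite, 'n::finite) params \<Rightarrow> ('m, 'n) params \<Rightarrow> real^'n \<Rightarrow> real" where
  "net_partial_fun \<sigma> i p x = deriv (\<lambda>t. net_fun \<sigma> (p + t *\<^sub>R i) x) 0"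

definition net_partial ::
    "(real \<Rightarrow> real) \<Rightarrow> ('m::finite, 'n::finite) params \<Rightarrow> ('m, 'n) params \<Rightarrow> 'n L2_cube" where
  "net_partial \<sigma> i p = to_L2 (net_partial_fun \<sigma> i p)"

definition net_deriv ::
    "(real \<Rightarrow> real) \<Rightarrow> ('m::finite, 'n::finite) params \<Rightarrow> ('m, 'n) params \<Rightarrow> 'n L2_cube" where
  "net_deriv \<sigma> p q = (\<Sum>i\<in>Basis. (q \<bullet> i) *\<^sub>R net_partial \<sigma> i p)"

text \<open>Linear independence of the family of partial derivatives, hence the injectivity condition.
  The largest set of parameters with this property is the set of all of them.\<close>

definition net_dom :: "(real \<Rightarrow> real) \<Rightarrow> ('m::finite, 'n::finite) params set" where
  "net_dom \<sigma> = {p. inj_on (\<lambda>i. net_partial \<sigma> i p) Basis \<and>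
                   independent ((\<lambda>i. net_partial \<sigma> i p) ` Basis)}"

definition tangent_space ::
    "(real \<Rightarrow> real) \<Rightarrow> ('m::finite, 'n::finite) params \<Rightarrow> 'n L2_cube set" where
  "tangent_space \<sigma> p = span ((\<lambda>i. net_partial \<sigma> i p) ` Basis)"

text \<open>The next four operators carry their intended meaning for \<open>p \<in> net_dom \<sigma>\<close>, on the
  tangent space, on all of $L^2$, and on the range of an injective \<open>F\<close>, respectively.\<close>

definition net_deriv_inv ::
    "(real \<Rightarrow> real) \<Rightarrow> ('m::finite, 'n::finite) params \<Rightarrow> 'n L2_cube \<Rightarrow> ('m, 'n) params" where
  "net_deriv_inv \<sigma> p u = (THE q. u = (\<Sum>i\<in>Basis. (q \<bullet> i) *\<^sub>R net_partial \<sigma> i p))"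

definition tangent_part ::
    "(real \<Rightarrow> real) \<Rightarrow> ('m::finite, 'n::finite) params \<Rightarrow> 'n L2_cube \<Rightarrow> 'n L2_cube" where
  "tangent_part \<sigma> p u =
     (THE u1. u1 \<in> tangent_space \<sigma> p \<and>
        (\<exists>u2. u2 \<in> orthogonal_comp (tangent_space \<sigma> p) \<and> u = u1 + u2))"

definition net_deriv_pinv ::
    "(real \<Rightarrow> real) \<Rightarrow> ('m::finite, 'n::finite) params \<Rightarrow> 'n L2_cube \<Rightarrow> ('m, 'n) params" where
  "net_deriv_pinv \<sigma> p u = net_deriv_inv \<sigma> p (tangent_part \<sigma> p u)"

definition coder_deriv_pinv ::
    "('n::finite L2_cube \<Rightarrow> 'y) \<Rightarrow> (real \<Rightarrow> real) \<Rightarrow> ('m::finite, 'n) params \<Rightarrow> 'y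
       \<Rightarrow> ('m, 'n) params" where
  "coder_deriv_pinv F \<sigma> p z = net_deriv_pinv \<sigma> p (the_inv F z)"

primrec gauss_newton ::
    "('n::finite L2_cube \<Rightarrow> 'y::real_inner) \<Rightarrow> (real \<Rightarrow> real) \<Rightarrow> 'y
       \<Rightarrow> ('m::finite, 'n) params \<Rightarrow> nat \<Rightarrow> ('m, 'n) params" where
  "gauss_newton F \<sigma> y p0 0 = p0"
| "gauss_newton F \<sigma> y p0 (Suc k) =
     gauss_newton F \<sigma> y p0 k -
     coder_deriv_pinv F \<sigma> (gauss_newton F \<sigma> y p0 k) (F (net \<sigma> (gauss_newton F \<sigma> y p0 k)) - y)"

definition converges_quadratically :: "(nat \<Rightarrow> 'a::real_normed_vector) \<Rightarrow> 'a \<Rightarrow> bool" where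
  "converges_quadratically u l \<longleftrightarrow>
     u \<longlonglongrightarrow> l \<and> (\<exists>C\<ge>0. \<forall>k. norm (u (Suc k) - l) \<le> C * (norm (u k - l))\<^sup>2)"

end

theory Submission
  imports Defs
begin

text \<open>
  Write \<open>J p\<close> for the derivative of the network operator \<open>\<Psi>\<close>. As \<open>F\<close> is injective, a step reads
  \<open>p' = p - (J p)\<^sup>\<dagger> (\<Psi> p - \<Psi> p\<^sup>*)\<close>, where \<open>p\<^sup>*\<close> is the solution, so \<open>F\<close> plays no further role. The
  pseudo-inverse solves a least squares problem, which bounds \<open>\<parallel>J p (p' - p\<^sup>*)\<parallel>\<close> by the Taylor
  remainder \<open>\<parallel>\<Psi> p - \<Psi> p\<^sup>* - J p (p - p\<^sup>*)\<parallel> = O(\<parallel>p - p\<^sup>*\<parallel>\<^sup>2)\<close>. Since \<open>J p\<^sup>*\<close> is injective on a finite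
  dimensional space and \<open>J\<close> is Lipschitz at \<open>p\<^sup>*\<close>, \<open>J p\<close> is bounded below uniformly for \<open>p\<close> near \<open>p\<^sup>*\<close>.
  The remainder and the Lipschitz estimate are proved pointwise on the cube, which has measure 1.
\<close>

section \<open>Elements of $L^2$ given by functions\<close>

lemma to_L2_add:
  "\<lbrakk>square_integrable f; square_integrable g\<rbrakk> \<Longrightarrow> to_L2 f + to_L2 g = to_L2 (\<lambda>x. f x + g x)"
  by (simp add: plus_L2_cube.abs_eq L2_eq_def)

lemma to_L2_diff:
  "\<lbrakk>square_integrable f; square_integrable g\<rbrakk> \<Longrightarrow> to_L2 f - to_L2 g = to_L2 (\<lambda>x. f x - g x)"
  by (simp add: minus_L2_cube.abs_eq L2_eq_def)

lemma to_L2_scaleR: "square_integrable f \<Longrightarrow> c *\<^sub>R to_L2 f = to_L2 (\<lambda>x. c * f x)"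
  by (simp add: scaleR_L2_cube.abs_eq L2_eq_def)

lemma to_L2_sum:
  assumes "finite A" and "\<And>i. i \<in> A \<Longrightarrow> square_integrable (f i)"
  shows "square_integrable (\<lambda>x. \<Sum>i\<in>A. f i x) \<and> (\<Sum>i\<in>A. to_L2 (f i)) = to_L2 (\<lambda>x. \<Sum>i\<in>A. f i x)"
  using assms
proof (induction A rule: finite_induct)
  case empty
  then show ?case by (simp add: square_integrable_zero zero_L2_cube.abs_eq)
next
  case (insert a A)
  then show ?case by (simp add: to_L2_add square_integrable_add)
qed

text \<open>The bridge from pointwise to norm estimates: on a space of total mass 1, integrating
  \<open>(f x)\<^sup>2 \<le> C\<^sup>2\<close> costs no extra factor.\<close>

lemma norm_to_L2_le:
  fixes f :: "real^'n::finite \<Rightarrow> real"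
  assumes f: "square_integrable f" and C: "0 \<le> C" and le: "\<And>x. x \<in> unit_cube \<Longrightarrow> \<bar>f x\<bar> \<le> C"
  shows "norm (to_L2 f) \<le> C"
proof -
  let ?\<mu> = "cube_measure :: (real^'n) measure"
  have sp: "space ?\<mu> = unit_cube" by (simp add: space_restrict_space)
  \<comment> \<open>The product of the unit side lengths. It serves twice: constants become
    integrable, and the integral of \<open>C\<^sup>2\<close> is \<open>C\<^sup>2\<close>
    itself.\<close>
  have em: "emeasure ?\<mu> (space ?\<mu>) = 1"
  proof -
    have "(\<Prod>b\<in>Basis. (1 - 0 :: real^'n) \<bullet> b) = 1"
      by (rule prod.neutral) (auto simp: Basis_vec_def inner_axis)
    moreover have "\<forall>b\<in>Basis. (0 :: real^'n) \<bullet> b \<le> 1 \<bullet> b"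
      by (auto simp: Basis_vec_def inner_axis)
    ultimately have "emeasure lborel (cbox 0 1 :: (real^'n) set) = 1"
      by (simp add: emeasure_lborel_cbox_eq)
    then show ?thesis
      unfolding sp by (subst emeasure_restrict_space) (auto simp: unit_cube_def)
  qed
  have int1: "integrable ?\<mu> (\<lambda>_. C\<^sup>2)"
    using em by (intro finite_measure.integrable_const finite_measureI) simp
  have "(norm (to_L2 f))\<^sup>2 = integral\<^sup>L ?\<mu> (\<lambda>x. f x * f x)"
    using f by (simp add: power2_norm_eq_inner inner_L2_cube_def L2_inner.abs_eq L2_eq_def)
  also have "\<dots> \<le> integral\<^sup>L ?\<mu> (\<lambda>_. C\<^sup>2)"
  proof (rule integral_mono)
    fix x assume "x \<in> space ?\<mu>"
    then have "\<bar>f x\<bar>\<^sup>2 \<le> C\<^sup>2" using le sp by (intro power_mono) auto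
    then show "f x * f x \<le> C\<^sup>2" by (simp add: power2_eq_square)
  qed (use int1 square_integrable_product[OF f f] in auto)
  also have "\<dots> = C\<^sup>2" using em by (simp add: measure_def)
  finally show ?thesis using C by (rule power2_le_imp_le)
qed

section \<open>The derivative and the least squares property\<close>

lemma linear_net_deriv: "linear (net_deriv \<sigma> p)"
  by (rule linearI)
    (simp_all add: net_deriv_def inner_add_left scaleR_add_left sum.distrib scaleR_sum_right)

lemma net_deriv_Basis: "i \<in> Basis \<Longrightarrow> net_deriv \<sigma> p i = net_partial \<sigma> i p"
  by (simp add: net_deriv_def inner_Basis if_distrib[of "\<lambda>c. c *\<^sub>R _"] sum.delta cong: if_cong)

text \<open>Gives every tangent vector a coordinate vector, on which the pseudo-inverse can then be
  evaluated.\<close>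

lemma tangent_space_eq: "tangent_space \<sigma> p = range (net_deriv \<sigma> p)"
proof
  have "subspace (range (net_deriv \<sigma> p))"
    using linear_subspace_image[OF linear_net_deriv subspace_UNIV] .
  then show "tangent_space \<sigma> p \<subseteq> range (net_deriv \<sigma> p)"
    unfolding tangent_space_def
    by (intro span_minimal) (auto simp: net_deriv_Basis[symmetric])
  show "range (net_deriv \<sigma> p) \<subseteq> tangent_space \<sigma> p"
    unfolding tangent_space_def net_deriv_def
    by (intro image_subsetI span_sum span_scale span_base imageI)
qed

lemma net_deriv_eq_0:
  assumes p: "p \<in> net_dom \<sigma>" and 0: "net_deriv \<sigma> p q = 0"
  shows "q = 0"
proof (rule euclidean_eqI)
  fix i :: "('a, 'b) params" assume i: "i \<in> Basis"
  let ?f = "\<lambda>i. net_partial \<sigma> i p"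
  have inj: "inj_on ?f Basis" and ind: "independent (?f ` Basis)"
    using p by (auto simp: net_dom_def)
  \<comment> \<open>\<open>independent\<close> speaks of a set, not of an indexed family;
    injectivity of the family allows the sum over \<open>Basis\<close> to be reindexed by its
    image.\<close>
  have "(\<Sum>v\<in>?f ` Basis. (q \<bullet> inv_into Basis ?f v) *\<^sub>R v) = 0"
    using 0 by (simp add: net_deriv_def sum.reindex[OF inj] inv_into_f_f[OF inj])
  then have "q \<bullet> inv_into Basis ?f (?f i) = 0"
    using i by (intro independentD[OF ind, of "?f ` Basis"]) auto
  then show "q \<bullet> i = 0 \<bullet> i"
    using inv_into_f_f[OF inj i] by simp
qed

section \<open>Orthogonal projection onto the tangent space, and least squares\<close>

lemma orthogonal_decomposition_span:
  fixes B :: "'a::real_inner set"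
  assumes "finite B"
  obtains u1 u2 where "u1 \<in> span B" "u2 \<in> orthogonal_comp (span B)" "u = u1 + u2"
proof -
  obtain C where C: "finite C" "span C = span B" "pairwise orthogonal C"
    using basis_orthogonal[OF assms] by blast
  \<comment> \<open>The Fourier expansion of \<open>u\<close> along \<open>C\<close>. A zero vector
    in \<open>C\<close> does no harm: its coefficient is \<open>0 / 0 = 0\<close>, and
    \<open>x \<bullet> u\<close> below vanishes for \<open>x = 0\<close> as well.\<close>
  let ?u1 = "\<Sum>b\<in>C. (b \<bullet> u / (b \<bullet> b)) *\<^sub>R b"
  have "orthogonal (u - ?u1) x" if x: "x \<in> C" for x
  proof -
    have "?u1 \<bullet> x = (\<Sum>b\<in>C. if b = x then x \<bullet> u else 0)"
      unfolding inner_sum_left using x C(3)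
      by (intro sum.cong) (auto simp: pairwise_def orthogonal_def)
    then show ?thesis
      using x C(1) by (simp add: orthogonal_def inner_diff_left inner_commute[of x u])
  qed
  then have "orthogonal (u - ?u1) x" if "x \<in> span B" for x
    using that C(2) orthogonal_to_span[of x C "u - ?u1"] by blast
  then have "u - ?u1 \<in> orthogonal_comp (span B)"
    by (auto simp: orthogonal_comp_def orthogonal_commute)
  moreover have "?u1 \<in> span B"
    using C(2) by (metis (no_types, lifting) span_sum span_scale span_base)
  ultimately show thesis using that[of ?u1 "u - ?u1"] by simp
qed

text \<open>Two tangent components of the same vector differ by something both tangent and normal,
  hence orthogonal to itself; so the definite description is well defined.\<close>

lemma tangent_part_eqI:
  assumes "u1 \<in> tangent_space \<sigma> p" "u2 \<in> orthogonal_comp (tangent_space \<sigma> p)" "u = u1 + u2"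
  shows "tangent_part \<sigma> p u = u1"
  unfolding tangent_part_def
proof (rule the_equality)
  fix v1 assume v: "v1 \<in> tangent_space \<sigma> p \<and> (\<exists>v2. v2 \<in> orthogonal_comp (tangent_space \<sigma> p) \<and> u = v1 + v2)"
  then obtain v2 where v2: "v2 \<in> orthogonal_comp (tangent_space \<sigma> p)" "u = v1 + v2" by blast
  have eq: "v1 - u1 = u2 - v2" using v2(2) assms(3) by (simp add: algebra_simps)
  have "v1 - u1 \<in> tangent_space \<sigma> p"
    using v assms(1) unfolding tangent_space_def by (auto intro: span_diff)
  moreover have "u2 - v2 \<in> orthogonal_comp (tangent_space \<sigma> p)"
    using subspace_orthogonal_comp assms(2) v2(1) by (rule subspace_diff)
  ultimately have "orthogonal (v1 - u1) (v1 - u1)"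
    unfolding eq[symmetric] by (simp add: orthogonal_comp_def)
  then show "v1 = u1" by (simp add: orthogonal_def)
qed (use assms in blast)

lemma net_deriv_inv_net_deriv:
  assumes "p \<in> net_dom \<sigma>"
  shows "net_deriv_inv \<sigma> p (net_deriv \<sigma> p q) = q"
  unfolding net_deriv_inv_def net_deriv_def[symmetric]
proof (rule the_equality)
  fix q' assume "net_deriv \<sigma> p q = net_deriv \<sigma> p q'"
  then have "net_deriv \<sigma> p (q' - q) = 0" by (simp add: linear_diff[OF linear_net_deriv])
  then show "q' = q" using net_deriv_eq_0[OF assms] by fastforce
qed simp

text \<open>The residual \<open>u - net_deriv \<sigma> p q\<close> splits into a tangent part and
  the normal part of \<open>u\<close>; by Pythagoras, dropping the normal part can only shorten it.
  It is applied to \<open>u = \<Psi> p - \<Psi> p'\<close> and \<open>q = p - p'\<close>, where the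
  right-hand side is the Taylor remainder.\<close>

lemma net_deriv_pinv_least_squares:
  assumes p: "p \<in> net_dom \<sigma>"
  shows "norm (net_deriv \<sigma> p (net_deriv_pinv \<sigma> p u - q)) \<le> norm (u - net_deriv \<sigma> p q)"
proof -
  obtain u1 u2 where u: "u1 \<in> tangent_space \<sigma> p" "u2 \<in> orthogonal_comp (tangent_space \<sigma> p)" "u = u1 + u2"
  proof (rule orthogonal_decomposition_span)
    show "finite ((\<lambda>i. net_partial \<sigma> i p) ` Basis)" by simp
  qed (rule that; simp add: tangent_space_def)
  obtain q1 where q1: "u1 = net_deriv \<sigma> p q1" using u(1) by (auto simp: tangent_space_eq)
  have "net_deriv_pinv \<sigma> p u = q1"
    using tangent_part_eqI[OF u] net_deriv_inv_net_deriv[OF p] by (simp add: net_deriv_pinv_def q1)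
  then have eq: "u - net_deriv \<sigma> p q = net_deriv \<sigma> p (net_deriv_pinv \<sigma> p u - q) + u2"
    by (simp add: u(3) q1 linear_diff[OF linear_net_deriv])
  have "orthogonal (net_deriv \<sigma> p (net_deriv_pinv \<sigma> p u - q)) u2"
  proof -
    have "net_deriv \<sigma> p (net_deriv_pinv \<sigma> p u - q) \<in> tangent_space \<sigma> p"
      unfolding tangent_space_eq by (rule rangeI)
    then show ?thesis using u(2) by (simp add: orthogonal_comp_def)
  qed
  from norm_add_Pythagorean[OF this] show ?thesis
    unfolding eq by - (rule power2_le_imp_le, simp_all)
qed

text \<open>The minimum of the norm over the compact unit sphere is attained, and positive by
  injectivity; homogeneity carries it to all \<open>q\<close>.\<close>

lemma net_deriv_bounded_below:
  fixes p :: "('m::finite, 'n::finite) params"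
  assumes p: "p \<in> net_dom \<sigma>"
  obtains c where "c > 0" "\<And>q. c * norm q \<le> norm (net_deriv \<sigma> p q)"
proof -
  let ?f = "\<lambda>q :: ('m, 'n) params. norm (net_deriv \<sigma> p q)"
  let ?S = "sphere 0 1 :: ('m, 'n) params set"
  have "continuous_on ?S ?f"
    unfolding net_deriv_def by (intro continuous_intros)
  moreover have "?S \<noteq> {}" by simp
  ultimately obtain z where z: "z \<in> ?S" and min: "\<And>q. q \<in> ?S \<Longrightarrow> ?f z \<le> ?f q"
    using continuous_attains_inf[OF compact_sphere] by blast
  have "?f z > 0" using z net_deriv_eq_0[OF p] by fastforce
  moreover have "?f z * norm q \<le> ?f q" for q
  proof (cases "q = 0")
    case False
    have "?f z \<le> ?f (q /\<^sub>R norm q)" using False by (intro min) simp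
    then show ?thesis using False
      by (simp add: linear_scale[OF linear_net_deriv] field_simps)
  qed (simp add: linear_0[OF linear_net_deriv])
  ultimately show thesis using that by blast
qed

section \<open>Pointwise estimates for shallow networks\<close>

text \<open>The argument of \<open>\<sigma>\<close> at neuron \<open>j\<close>. It is isolated
  because it is linear in the parameters, so a difference of arguments is the argument of a
  difference.\<close>

definition preact :: "('m::finite, 'n::finite) params \<Rightarrow> real^'n \<Rightarrow> 'm \<Rightarrow> real" where
  "preact p x j = fst (snd p) $ j \<bullet> x + snd (snd p) $ j"

lemma preact_diff: "preact (p - q) x j = preact p x j - preact q x j"
  by (simp add: preact_def inner_diff_left)

lemma linear_preact: "linear (\<lambda>p. preact p x j)"
  by (rule linearI) (simp_all add: preact_def inner_add_left algebra_simps)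

lemma net_fun_eq: "net_fun \<sigma> p x = (\<Sum>j\<in>UNIV. fst p $ j * \<sigma> (preact p x j))"
  by (simp add: net_fun_def preact_def split_beta)

lemma abs_fst_nth_le: "\<bar>fst p $ j\<bar> \<le> norm p" for p :: "('m::finite, 'n::finite) params"
  using component_le_norm_cart[of "fst p" j] norm_fst_le[of "fst p" "snd p"] by simp

text \<open>Cauchy-Schwarz for the weights with the crude bound \<open>norm x \<le> n\<close> on the
  cube, taken from the l1 norm; the extra 1 accounts for the bias.\<close>

lemma abs_preact_le:
  fixes p :: "('m::finite, 'n::finite) params"
  assumes "x \<in> unit_cube"
  shows "\<bar>preact p x j\<bar> \<le> (real CARD('n) + 1) * norm p"
proof -
  have "norm x \<le> (\<Sum>i\<in>UNIV. \<bar>x $ i\<bar>)" by (rule norm_le_l1_cart)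
  also have "\<dots> \<le> (\<Sum>i\<in>(UNIV::'n set). 1)"
    using assms by (intro sum_mono) (auto simp: unit_cube_def mem_box_cart)
  finally have x: "norm x \<le> CARD('n)" by simp
  have le: "norm (snd p) \<le> norm p" "norm (fst (snd p)) \<le> norm (snd p)" "norm (snd (snd p)) \<le> norm (snd p)"
    by (metis norm_fst_le norm_snd_le prod.collapse)+
  have "\<bar>fst (snd p) $ j \<bullet> x\<bar> \<le> norm (fst (snd p) $ j) * norm x" by (rule Cauchy_Schwarz_ineq2)
  also have "\<dots> \<le> norm p * CARD('n)"
    using le x Finite_Cartesian_Product.norm_nth_le[of "fst (snd p)" j] by (intro mult_mono) auto
  finally have "\<bar>fst (snd p) $ j \<bullet> x\<bar> \<le> norm p * CARD('n)" .
  moreover have "\<bar>snd (snd p) $ j\<bar> \<le> norm p"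
    using le component_le_norm_cart[of "snd (snd p)" j] by simp
  ultimately show ?thesis by (simp add: preact_def algebra_simps)
qed

section \<open>Activation functions with one common bound for values and two derivatives\<close>

locale bounded_activation =
  fixes \<sigma> :: "real \<Rightarrow> real" and B :: real
  assumes DERIV_activation: "(\<sigma> has_field_derivative deriv \<sigma> t) (at t)"
    and DERIV_deriv: "(deriv \<sigma> has_field_derivative deriv (deriv \<sigma>) t) (at t)"
    and bounds: "\<bar>\<sigma> t\<bar> \<le> B" "\<bar>deriv \<sigma> t\<bar> \<le> B" "\<bar>deriv (deriv \<sigma>) t\<bar> \<le> B"
begin

lemma B_nonneg: "0 \<le> B"
  using bounds(1)[of 0] by simp

lemma activation_lipschitz: "\<bar>\<sigma> a - \<sigma> b\<bar> \<le> B * \<bar>a - b\<bar>"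
  using field_differentiable_bound[of UNIV \<sigma> "deriv \<sigma>" B a b] DERIV_activation bounds by simp

lemma deriv_lipschitz: "\<bar>deriv \<sigma> a - deriv \<sigma> b\<bar> \<le> B * \<bar>a - b\<bar>"
  using field_differentiable_bound[of UNIV "deriv \<sigma>" "deriv (deriv \<sigma>)" B a b] DERIV_deriv bounds by simp

text \<open>The mean value inequality for \<open>\<sigma> t - deriv \<sigma> a * t\<close> on the
  segment, where its derivative is at most \<open>B * \<bar>b - a\<bar>\<close>. The usual factor
  1/2 is given up.\<close>

lemma activation_taylor: "\<bar>\<sigma> b - \<sigma> a - deriv \<sigma> a * (b - a)\<bar> \<le> B * (b - a)\<^sup>2"
proof -
  let ?g = "\<lambda>t. \<sigma> t - deriv \<sigma> a * t"
  have d: "(?g has_field_derivative deriv \<sigma> t - deriv \<sigma> a) (at t within S)" for t S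
    by (auto intro!: derivative_eq_intros DERIV_subset[OF DERIV_activation])
  have "\<bar>deriv \<sigma> t - deriv \<sigma> a\<bar> \<le> B * \<bar>b - a\<bar>" if t: "t \<in> closed_segment a b" for t
  proof -
    have "\<bar>t - a\<bar> \<le> \<bar>b - a\<bar>" using t by (auto simp: closed_segment_eq_real_ivl split: if_splits)
    then show ?thesis using deriv_lipschitz[of t a] B_nonneg
      by (meson mult_left_mono order_trans)
  qed
  then have "norm (?g b - ?g a) \<le> B * \<bar>b - a\<bar> * norm (b - a)"
    by (intro field_differentiable_bound[where S = "closed_segment a b" and f = ?g
          and f' = "\<lambda>t. deriv \<sigma> t - deriv \<sigma> a"] d) auto
  then show ?thesis by (simp add: algebra_simps power2_eq_square abs_mult_self_eq flip: abs_mult)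
qed

section \<open>Square integrability and directional derivatives of the network\<close>

lemma continuous_on_activation [continuous_intros]:
  "continuous_on S f \<Longrightarrow> continuous_on S (\<lambda>x. \<sigma> (f x))"
  by (rule continuous_on_compose2[where t = UNIV])
    (auto intro: DERIV_isCont[OF DERIV_activation] continuous_at_imp_continuous_on)

lemma continuous_on_deriv [continuous_intros]:
  "continuous_on S f \<Longrightarrow> continuous_on S (\<lambda>x. deriv \<sigma> (f x))"
  by (rule continuous_on_compose2[where t = UNIV])
    (auto intro: DERIV_isCont[OF DERIV_deriv] continuous_at_imp_continuous_on)

lemma net_partial_fun_eq:
  "net_partial_fun \<sigma> q p x =
     (\<Sum>j\<in>UNIV. fst q $ j * \<sigma> (preact p x j) + fst p $ j * (deriv \<sigma> (preact p x j) * preact q x j))"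
proof -
  have eq: "net_fun \<sigma> (p + t *\<^sub>R q) x =
      (\<Sum>j\<in>UNIV. (fst p $ j + t * fst q $ j) * \<sigma> (preact p x j + t * preact q x j))" for t
    by (simp add: net_fun_eq linear_add[OF linear_preact] linear_scale[OF linear_preact])
  have "((\<lambda>t. \<sigma> (preact p x j + t * preact q x j)) has_field_derivative
          deriv \<sigma> (preact p x j) * preact q x j) (at 0)" for j
    by (rule DERIV_chain2[where g = "\<lambda>t. preact p x j + t * preact q x j"])
      (auto intro!: derivative_eq_intros DERIV_activation)
  then show ?thesis
    unfolding net_partial_fun_def eq
    by (intro DERIV_imp_deriv) (auto intro!: derivative_eq_intros sum.cong simp: algebra_simps)
qed

lemma linear_net_partial_fun: "linear (\<lambda>q. net_partial_fun \<sigma> q p x)"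
  by (rule linearI)
    (simp_all add: net_partial_fun_eq linear_add[OF linear_preact] linear_scale[OF linear_preact]
      sum.distrib[symmetric] sum_distrib_left algebra_simps)

lemma square_integrable_net_fun: "square_integrable (net_fun \<sigma> p)"
  by (rule square_integrable_continuous) (auto simp: net_fun_eq[abs_def] preact_def intro!: continuous_intros)

lemma square_integrable_net_partial_fun: "square_integrable (net_partial_fun \<sigma> q p)"
  by (rule square_integrable_continuous)
    (auto simp: net_partial_fun_eq[abs_def] preact_def intro!: continuous_intros)

text \<open>The pointwise directional derivative is linear in the direction, so the sum over
  \<open>Basis\<close> collapses to one explicit function, to which pointwise bounds apply.\<close>

lemma net_deriv_eq: "net_deriv \<sigma> p q = to_L2 (net_partial_fun \<sigma> q p)"
proof -
  have "net_deriv \<sigma> p q = (\<Sum>i\<in>Basis. to_L2 (\<lambda>x. (q \<bullet> i) * net_partial_fun \<sigma> i p x))"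
    by (simp add: net_deriv_def net_partial_def to_L2_scaleR square_integrable_net_partial_fun)
  also have "\<dots> = to_L2 (\<lambda>x. \<Sum>i\<in>Basis. (q \<bullet> i) * net_partial_fun \<sigma> i p x)"
    by (intro conjunct2[OF to_L2_sum] square_integrable_scale square_integrable_net_partial_fun) auto
  also have "(\<lambda>x. \<Sum>i\<in>Basis. (q \<bullet> i) * net_partial_fun \<sigma> i p x) = net_partial_fun \<sigma> q p"
  proof
    fix x
    have "net_partial_fun \<sigma> (\<Sum>i\<in>Basis. (q \<bullet> i) *\<^sub>R i) p x = (\<Sum>i\<in>Basis. (q \<bullet> i) * net_partial_fun \<sigma> i p x)"
      by (simp add: linear_sum[OF linear_net_partial_fun] linear_scale[OF linear_net_partial_fun]
          del: euclidean_representation)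
    then show "(\<Sum>i\<in>Basis. (q \<bullet> i) * net_partial_fun \<sigma> i p x) = net_partial_fun \<sigma> q p x"
      by (simp add: euclidean_representation)
  qed
  finally show ?thesis .
qed

text \<open>The constant involves only the anchor \<open>p'\<close>, so the estimate holds for every
  \<open>p\<close>: wherever the outer weights of \<open>p\<close> occur, they enter through their
  difference from those of \<open>p'\<close>.\<close>

lemma net_partial_fun_lipschitz:
  fixes p p' q :: "('m::finite, 'n::finite) params"
  assumes x: "x \<in> unit_cube"
  defines "s \<equiv> real CARD('n) + 1"
  shows "\<bar>net_partial_fun \<sigma> q p x - net_partial_fun \<sigma> q p' x\<bar>
           \<le> CARD('m) * (2 * B * s + norm p' * B * s\<^sup>2) * (norm (p - p') * norm q)"
proof -
  have s: "0 \<le> s" by (simp add: s_def)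
  have pre: "\<bar>preact v x j\<bar> \<le> s * norm v" for v :: "('m, 'n) params" and j
    using abs_preact_le[OF x, of v j] by (simp only: s_def)
  have "\<bar>net_partial_fun \<sigma> q p x - net_partial_fun \<sigma> q p' x\<bar> \<le>
      (\<Sum>j\<in>UNIV. \<bar>(fst q $ j * \<sigma> (preact p x j) + fst p $ j * (deriv \<sigma> (preact p x j) * preact q x j))
        - (fst q $ j * \<sigma> (preact p' x j) + fst p' $ j * (deriv \<sigma> (preact p' x j) * preact q x j))\<bar>)"
    unfolding net_partial_fun_eq sum_subtractf[symmetric] by (rule sum_abs)
  also have "\<dots> \<le> (\<Sum>j\<in>(UNIV::'m set). (2 * B * s + norm p' * B * s\<^sup>2) * (norm (p - p') * norm q))"
  proof (rule sum_mono)
    fix j :: 'm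
    let ?a = "preact p x j" and ?a' = "preact p' x j" and ?l = "preact q x j"
    have a: "\<bar>?a - ?a'\<bar> \<le> s * norm (p - p')"
      using pre[of "p - p'" j] by (simp add: preact_diff)
    have 1: "\<bar>fst q $ j * (\<sigma> ?a - \<sigma> ?a')\<bar> \<le> norm q * (B * (s * norm (p - p')))"
      unfolding abs_mult
      using order_trans[OF activation_lipschitz mult_left_mono[OF a B_nonneg]]
      by (intro mult_mono abs_fst_nth_le) simp_all
    have 2: "\<bar>(fst p $ j - fst p' $ j) * (deriv \<sigma> ?a * ?l)\<bar> \<le> norm (p - p') * (B * (s * norm q))"
      unfolding abs_mult
      using abs_fst_nth_le[of "p - p'" j] B_nonneg s
      by (intro mult_mono bounds(2) pre) simp_all
    have 3: "\<bar>fst p' $ j * ((deriv \<sigma> ?a - deriv \<sigma> ?a') * ?l)\<bar>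
               \<le> norm p' * ((B * (s * norm (p - p'))) * (s * norm q))"
      unfolding abs_mult
      using order_trans[OF deriv_lipschitz mult_left_mono[OF a B_nonneg]] B_nonneg s
      by (intro mult_mono abs_fst_nth_le pre) simp_all
    \<comment> \<open>Telescoping: each summand changes a single factor from \<open>p'\<close> to
      \<open>p\<close>.\<close>
    have "(fst q $ j * \<sigma> ?a + fst p $ j * (deriv \<sigma> ?a * ?l)) - (fst q $ j * \<sigma> ?a' + fst p' $ j * (deriv \<sigma> ?a' * ?l))
        = fst q $ j * (\<sigma> ?a - \<sigma> ?a') + (fst p $ j - fst p' $ j) * (deriv \<sigma> ?a * ?l)
          + fst p' $ j * ((deriv \<sigma> ?a - deriv \<sigma> ?a') * ?l)"
      by (simp add: algebra_simps)
    then have "\<bar>(fst q $ j * \<sigma> ?a + fst p $ j * (deriv \<sigma> ?a * ?l)) - (fst q $ j * \<sigma> ?a' + fst p' $ j * (deriv \<sigma> ?a' * ?l))\<bar>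
        \<le> norm q * (B * (s * norm (p - p'))) + norm (p - p') * (B * (s * norm q))
          + norm p' * ((B * (s * norm (p - p'))) * (s * norm q))"
      by (simp only:) (intro order_trans[OF abs_triangle_ineq] add_mono 1 2 3)
    also have "\<dots> = (2 * B * s + norm p' * B * s\<^sup>2) * (norm (p - p') * norm q)"
      by (simp add: algebra_simps power2_eq_square)
    finally show "\<bar>(fst q $ j * \<sigma> ?a + fst p $ j * (deriv \<sigma> ?a * ?l)) - (fst q $ j * \<sigma> ?a' + fst p' $ j * (deriv \<sigma> ?a' * ?l))\<bar>
        \<le> (2 * B * s + norm p' * B * s\<^sup>2) * (norm (p - p') * norm q)" .
  qed
  also have "\<dots> = CARD('m) * (2 * B * s + norm p' * B * s\<^sup>2) * (norm (p - p') * norm q)"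
    by simp
  finally show ?thesis .
qed

text \<open>The linearisation is taken at the moving point \<open>p\<close>, as in a Gauss-Newton
  step, while the constant depends only on the fixed point \<open>p'\<close>.\<close>

lemma net_fun_taylor:
  fixes p p' :: "('m::finite, 'n::finite) params"
  assumes x: "x \<in> unit_cube"
  defines "s \<equiv> real CARD('n) + 1"
  shows "\<bar>net_fun \<sigma> p x - net_fun \<sigma> p' x - net_partial_fun \<sigma> (p - p') p x\<bar>
           \<le> CARD('m) * (B * s + norm p' * B * s\<^sup>2) * (norm (p - p'))\<^sup>2"
proof -
  let ?e = "norm (p - p')"
  have s: "0 \<le> s" by (simp add: s_def)
  define r where "r j = fst p $ j * \<sigma> (preact p x j) - fst p' $ j * \<sigma> (preact p' x j)
      - (fst (p - p') $ j * \<sigma> (preact p x j) + fst p $ j * (deriv \<sigma> (preact p x j) * preact (p - p') x j))" for j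
  have "\<bar>net_fun \<sigma> p x - net_fun \<sigma> p' x - net_partial_fun \<sigma> (p - p') p x\<bar> \<le> (\<Sum>j\<in>UNIV. \<bar>r j\<bar>)"
    unfolding net_partial_fun_eq net_fun_eq sum_subtractf[symmetric] r_def by (rule sum_abs)
  also have "\<dots> \<le> (\<Sum>j\<in>(UNIV::'m set). (B * s + norm p' * B * s\<^sup>2) * ?e\<^sup>2)"
  proof (rule sum_mono)
    fix j :: 'm
    let ?a = "preact p x j" and ?a' = "preact p' x j"
    have a: "\<bar>?a' - ?a\<bar> \<le> s * ?e"
      using abs_preact_le[OF x, of "p - p'" j] unfolding s_def preact_diff by (subst abs_minus_commute)
    then have "(?a' - ?a)\<^sup>2 \<le> (s * ?e)\<^sup>2"
      by (metis abs_ge_zero power2_abs power_mono)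
    then have "\<bar>\<sigma> ?a' - \<sigma> ?a - deriv \<sigma> ?a * (?a' - ?a)\<bar> \<le> B * (s * ?e)\<^sup>2"
      using activation_taylor B_nonneg by (meson mult_left_mono order_trans)
    then have 1: "\<bar>fst p' $ j * (\<sigma> ?a' - \<sigma> ?a - deriv \<sigma> ?a * (?a' - ?a))\<bar> \<le> norm p' * (B * (s * ?e)\<^sup>2)"
      unfolding abs_mult by (intro mult_mono abs_fst_nth_le) simp_all
    have 2: "\<bar>(fst p $ j - fst p' $ j) * (deriv \<sigma> ?a * (?a' - ?a))\<bar> \<le> ?e * (B * (s * ?e))"
      unfolding abs_mult
      using abs_fst_nth_le[of "p - p'" j] B_nonneg s by (intro mult_mono bounds(2) a) simp_all
    \<comment> \<open>Both terms are of second order: a product of two first-order differences, and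
      the Taylor remainder of \<open>\<sigma>\<close> at \<open>?a\<close>.\<close>
    have "r j = (fst p $ j - fst p' $ j) * (deriv \<sigma> ?a * (?a' - ?a))
        - fst p' $ j * (\<sigma> ?a' - \<sigma> ?a - deriv \<sigma> ?a * (?a' - ?a))"
      by (simp add: r_def preact_diff algebra_simps)
    then have "\<bar>r j\<bar> \<le> ?e * (B * (s * ?e)) + norm p' * (B * (s * ?e)\<^sup>2)"
      by (simp only:) (intro order_trans[OF abs_triangle_ineq4] add_mono 1 2)
    also have "\<dots> = (B * s + norm p' * B * s\<^sup>2) * ?e\<^sup>2"
      by (simp add: algebra_simps power2_eq_square)
    finally show "\<bar>r j\<bar> \<le> (B * s + norm p' * B * s\<^sup>2) * ?e\<^sup>2" .
  qed
  finally show ?thesis by simp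
qed

section \<open>From pointwise to norm estimates, and the error of one step\<close>

lemma net_deriv_lipschitz_at:
  fixes p' :: "('m::finite, 'n::finite) params"
  obtains L where "L \<ge> 0"
    "\<And>p q. norm (net_deriv \<sigma> p q - net_deriv \<sigma> p' q) \<le> L * (norm (p - p') * norm q)"
proof
  let ?s = "real CARD('n) + 1"
  let ?L = "CARD('m) * (2 * B * ?s + norm p' * B * ?s\<^sup>2)"
  show L: "?L \<ge> 0" using B_nonneg by simp
  show "norm (net_deriv \<sigma> p q - net_deriv \<sigma> p' q) \<le> ?L * (norm (p - p') * norm q)" for p q
    unfolding net_deriv_eq to_L2_diff[OF square_integrable_net_partial_fun square_integrable_net_partial_fun]
    using L
    by (intro norm_to_L2_le square_integrable_diff square_integrable_net_partial_fun
        net_partial_fun_lipschitz mult_nonneg_nonneg[OF L]) auto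
qed

lemma net_taylor_at:
  fixes p' :: "('m::finite, 'n::finite) params"
  obtains K where "K \<ge> 0"
    "\<And>p. norm (net \<sigma> p - net \<sigma> p' - net_deriv \<sigma> p (p - p')) \<le> K * (norm (p - p'))\<^sup>2"
proof
  let ?s = "real CARD('n) + 1"
  let ?K = "CARD('m) * (B * ?s + norm p' * B * ?s\<^sup>2)"
  show K: "?K \<ge> 0" using B_nonneg by simp
  show "norm (net \<sigma> p - net \<sigma> p' - net_deriv \<sigma> p (p - p')) \<le> ?K * (norm (p - p'))\<^sup>2" for p
    unfolding net_deriv_eq net_def
    by (simp only: to_L2_diff square_integrable_diff square_integrable_net_fun square_integrable_net_partial_fun)
      (intro norm_to_L2_le square_integrable_diff square_integrable_net_fun
        square_integrable_net_partial_fun net_fun_taylor mult_nonneg_nonneg[OF K] zero_le_power2)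
qed

text \<open>The lower bound \<open>c\<close> for the derivative at \<open>p'\<close> loses at most
  \<open>c / 2\<close> on a small ball. Dividing the least squares bound by the remaining
  \<open>c / 2\<close> gives the constant \<open>2 * K / c\<close>.\<close>

lemma pinv_step_quadratic:
  fixes p' :: "('m::finite, 'n::finite) params"
  assumes op: "open (net_dom \<sigma> :: ('m, 'n) params set)" and p': "p' \<in> net_dom \<sigma>"
  obtains r K where "r > 0" "K \<ge> 0" "ball p' r \<subseteq> net_dom \<sigma>"
    "\<And>p. p \<in> ball p' r \<Longrightarrow>
       norm (p - net_deriv_pinv \<sigma> p (net \<sigma> p - net \<sigma> p') - p') \<le> K * (norm (p - p'))\<^sup>2"
proof -
  obtain c where c: "c > 0" "\<And>q. c * norm q \<le> norm (net_deriv \<sigma> p' q)"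
    using net_deriv_bounded_below[OF p'] by blast
  obtain L where L: "L \<ge> 0"
    "\<And>p q. norm (net_deriv \<sigma> p q - net_deriv \<sigma> p' q) \<le> L * (norm (p - p') * norm q)"
    using net_deriv_lipschitz_at by blast
  obtain K where K: "K \<ge> 0"
    "\<And>p. norm (net \<sigma> p - net \<sigma> p' - net_deriv \<sigma> p (p - p')) \<le> K * (norm (p - p'))\<^sup>2"
    using net_taylor_at by blast
  obtain r0 where r0: "r0 > 0" "ball p' r0 \<subseteq> net_dom \<sigma>"
    using op p' open_contains_ball by blast
  \<comment> \<open>The second entry forces \<open>L * r \<le> c / 2\<close>; \<open>L + 1\<close>
    avoids a division by zero if \<open>L = 0\<close>.\<close>
  define r where "r = min r0 (c / (2 * (L + 1)))"
  have r: "r > 0" "r \<le> r0" "L * r \<le> c / 2"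
  proof -
    show "r > 0" "r \<le> r0" using r0(1) c(1) L(1) by (auto simp: r_def)
    have "L * r \<le> (L + 1) * (c / (2 * (L + 1)))"
      using L(1) \<open>r > 0\<close> by (intro mult_mono) (auto simp: r_def)
    also have "\<dots> = c / 2" using L(1) by (simp add: field_split_simps)
    finally show "L * r \<le> c / 2" .
  qed
  show thesis
  proof
    show "r > 0" "2 * K / c \<ge> 0" "ball p' r \<subseteq> net_dom \<sigma>"
      using r r0 K(1) c(1) by auto
    fix p assume p: "p \<in> ball p' r"
    then have pd: "p \<in> net_dom \<sigma>" using r r0 by auto
    \<comment> \<open>Minus the error of the next iterate.\<close>
    let ?q = "net_deriv_pinv \<sigma> p (net \<sigma> p - net \<sigma> p') - (p - p')"
    have "L * (norm (p - p') * norm ?q) \<le> c / 2 * norm ?q"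
    proof -
      have "norm (p - p') \<le> r" using p by (simp add: dist_norm norm_minus_commute)
      then have "L * norm (p - p') \<le> c / 2" using r(3) L(1) by (meson mult_left_mono order_trans)
      then show ?thesis unfolding mult.assoc[symmetric] by (rule mult_right_mono) simp
    qed
    moreover have "norm (net_deriv \<sigma> p' ?q) \<le> norm (net_deriv \<sigma> p ?q) + norm (net_deriv \<sigma> p ?q - net_deriv \<sigma> p' ?q)"
      by (metis norm_minus_commute norm_triangle_sub)
    moreover have "norm (net_deriv \<sigma> p ?q) \<le> K * (norm (p - p'))\<^sup>2"
      using net_deriv_pinv_least_squares[OF pd] K(2) by (rule order_trans)
    \<comment> \<open>With \<open>e\<close> for \<open>norm (p - p')\<close>:
      \<open>c * norm ?q\<close> is at most \<open>K * e\<^sup>2 + c / 2 * norm ?q\<close>, and the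
      last term is absorbed on the left.\<close>
    ultimately have "c / 2 * norm ?q \<le> K * (norm (p - p'))\<^sup>2"
      using c(2)[of ?q] L(2)[of p ?q] by (simp add: field_simps)
    then have "norm ?q \<le> 2 * K / c * (norm (p - p'))\<^sup>2"
      using c(1) by (simp add: field_simps)
    moreover have "norm (p - net_deriv_pinv \<sigma> p (net \<sigma> p - net \<sigma> p') - p') = norm ?q"
    proof -
      have "p - net_deriv_pinv \<sigma> p (net \<sigma> p - net \<sigma> p') - p' = - ?q" by simp
      then show ?thesis by (metis norm_minus_cancel)
    qed
    ultimately show "norm (p - net_deriv_pinv \<sigma> p (net \<sigma> p - net \<sigma> p') - p') \<le> 2 * K / c * (norm (p - p'))\<^sup>2"
      by simp
  qed
qed

end

text \<open>By linearity the argument is \<open>F (u - v)\<close>, which lies in the range, so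
  \<open>the_inv F\<close> really inverts \<open>F\<close> there.\<close>

lemma coder_deriv_pinv_diff:
  assumes "bounded_linear F" and "\<And>u. F u = 0 \<Longrightarrow> u = 0"
  shows "coder_deriv_pinv F \<sigma> p (F u - F v) = net_deriv_pinv \<sigma> p (u - v)"
proof -
  interpret bounded_linear F by fact
  have "inj F" using assms(2) by (intro injI) (metis diff eq_iff_diff_eq_0)
  then show ?thesis by (simp add: coder_deriv_pinv_def diff[symmetric] the_inv_f_f)
qed

section \<open>Local quadratic convergence\<close>

text \<open>With \<open>K * \<delta> \<le> 1 / 2\<close> the quadratic estimate at least halves the
  error. The estimate is available only inside the ball, so geometric decay and membership must be
  carried through the same induction.\<close>

lemma quadratic_iteration:
  fixes u :: "nat \<Rightarrow> 'a::real_normed_vector"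
  assumes K: "0 \<le> K" and "\<delta> \<le> r" "K * \<delta> \<le> 1 / 2" and u0: "norm (u 0 - l) < \<delta>"
    and step: "\<And>k. u k \<in> ball l r \<Longrightarrow> norm (u (Suc k) - l) \<le> K * (norm (u k - l))\<^sup>2"
  shows "u k \<in> ball l r" and "converges_quadratically u l"
proof -
  have \<delta>: "0 < \<delta>" using u0 norm_ge_zero le_less_trans by blast
  have close: "norm (u k - l) < \<delta> * (1 / 2) ^ k" for k
  proof (induction k)
    case 0
    then show ?case using u0 by simp
  next
    case (Suc k)
    have le: "\<delta> * (1 / 2) ^ k \<le> \<delta>" using \<delta> by (simp add: power_le_one)
    then have "norm (u k - l) \<le> \<delta>" using Suc by simp
    then have half: "K * norm (u k - l) \<le> 1 / 2" using assms(3) K by (meson mult_left_mono order_trans)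
    have "u k \<in> ball l r" using Suc le assms(2) by (simp add: dist_norm norm_minus_commute)
    from step[OF this] have "norm (u (Suc k) - l) \<le> K * norm (u k - l) * norm (u k - l)"
      by (simp add: power2_eq_square)
    also have "\<dots> \<le> 1 / 2 * norm (u k - l)" using half by (rule mult_right_mono) simp
    also have "\<dots> < \<delta> * (1 / 2) ^ Suc k" using Suc by simp
    finally show ?case .
  qed
  have mem: "u k \<in> ball l r" for k
  proof -
    have "\<delta> * (1 / 2) ^ k \<le> \<delta>" using \<delta> by (simp add: power_le_one)
    then show ?thesis using close[of k] assms(2) by (simp add: dist_norm norm_minus_commute)
  qed
  then show "u k \<in> ball l r" .
  have "(\<lambda>k. \<delta> * (1 / 2) ^ k) \<longlonglongrightarrow> 0"
    by (intro tendsto_mult_right_zero LIMSEQ_power_zero) simp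
  then have "(\<lambda>k. u k - l) \<longlonglongrightarrow> 0"
    by (rule Lim_null_comparison[rotated]) (intro always_eventually allI less_imp_le close)
  then have "u \<longlonglongrightarrow> l" by (rule LIM_zero_cancel)
  then show "converges_quadratically u l"
    unfolding converges_quadratically_def using K step mem by blast
qed

theorem theorem3p19:
  fixes F :: "'n::finite L2_cube \<Rightarrow> 'y::{real_inner, complete_space}"
    and \<sigma> :: "real \<Rightarrow> real"
    and y :: 'y
    and pd :: "('m::finite, 'n) params"
  assumes "bounded_linear F"
    and "\<And>u. F u = 0 \<Longrightarrow> u = 0"
    and "closure (range F) = UNIV"
    and "\<And>t. \<sigma> t > 0"
    and "strict_mono \<sigma> \<or> strict_antimono_on UNIV \<sigma>"
    and "\<And>t. \<sigma> differentiable (at t)"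
    and "\<And>t. deriv \<sigma> differentiable (at t)"
    and "bounded (range \<sigma>)"
    and "bounded (range (deriv \<sigma>))"
    and "bounded (range (deriv (deriv \<sigma>)))"
    and "open (net_dom \<sigma> :: ('m, 'n) params set)"
    and "closure (net_dom \<sigma> :: ('m, 'n) params set) = UNIV"
    and "pd \<in> net_dom \<sigma>"
    and "F (net \<sigma> pd) = y"
  shows "\<exists>\<delta>>0. \<forall>p0 \<rho> C_I C_L.
           p0 \<in> net_dom \<sigma> \<longrightarrow>
           norm (p0 - pd) < \<delta> \<longrightarrow>
           \<rho> = norm (pd - p0) \<longrightarrow>
           closure (ball p0 \<rho>) \<subseteq> net_dom \<sigma> \<longrightarrow>
           (\<forall>p\<in>closure (ball p0 \<rho>). \<forall>q\<in>closure (ball p0 \<rho>).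
              onorm (\<lambda>v. net_deriv \<sigma> p v - net_deriv \<sigma> q v) \<le> C_L * norm (p - q)) \<longrightarrow>
           (\<forall>p\<in>closure (ball p0 \<rho>). onorm (net_deriv \<sigma> p) \<le> C_I) \<longrightarrow>
           \<rho> * C_I * C_L / 2 < 1 \<longrightarrow>
           (\<forall>k. gauss_newton F \<sigma> y p0 k \<in> net_dom \<sigma>) \<and>
           converges_quadratically (gauss_newton F \<sigma> y p0) pd"
proof -
  obtain B1 B2 B3 where B: "\<And>t. \<bar>\<sigma> t\<bar> \<le> B1" "\<And>t. \<bar>deriv \<sigma> t\<bar> \<le> B2" "\<And>t. \<bar>deriv (deriv \<sigma>) t\<bar> \<le> B3"
    using assms(8-10) unfolding bounded_iff by auto
  interpret bounded_activation \<sigma> "max B1 (max B2 B3)"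
    using assms(6,7) B
    by unfold_locales (auto simp: DERIV_deriv_iff_real_differentiable le_max_iff_disj)
  obtain r K where r: "r > 0" and K: "K \<ge> 0" and dom: "ball pd r \<subseteq> net_dom \<sigma>"
    and step: "\<And>p. p \<in> ball pd r \<Longrightarrow>
       norm (p - net_deriv_pinv \<sigma> p (net \<sigma> p - net \<sigma> pd) - pd) \<le> K * (norm (p - pd))\<^sup>2"
    using pinv_step_quadratic[OF assms(11,13)] by blast
  \<comment> \<open>Chosen before \<open>p0\<close>, with \<open>K + 1\<close> guarding against
    \<open>K = 0\<close>; it gives \<open>\<delta> \<le> r\<close> and
    \<open>K * \<delta> \<le> 1 / 2\<close>.\<close>
  define \<delta> where "\<delta> = min r (1 / (2 * (K + 1)))"
  have \<delta>: "\<delta> > 0" "\<delta> \<le> r" using r K by (auto simp: \<delta>_def)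
  have "K * \<delta> \<le> (K + 1) * (1 / (2 * (K + 1)))"
    using K \<delta> by (intro mult_mono) (auto simp: \<delta>_def)
  also have "\<dots> = 1 / 2" using K by simp
  finally have K\<delta>: "K * \<delta> \<le> 1 / 2" .
  have "(\<forall>k. gauss_newton F \<sigma> y p0 k \<in> net_dom \<sigma>) \<and> converges_quadratically (gauss_newton F \<sigma> y p0) pd"
    if "norm (p0 - pd) < \<delta>" for p0
  proof -
    let ?u = "gauss_newton F \<sigma> y p0"
    have u0: "norm (?u 0 - pd) < \<delta>" using that by simp
    have "norm (?u (Suc k) - pd) \<le> K * (norm (?u k - pd))\<^sup>2" if "?u k \<in> ball pd r" for k
      \<comment> \<open>Writing \<open>y\<close> as \<open>F (net \<sigma> pd)\<close> turns the
        residual into a difference of two values of \<open>F\<close>, so that \<open>F\<close>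
        cancels.\<close>
      using step[OF that] by (simp add: coder_deriv_pinv_diff[OF assms(1,2)] assms(14)[symmetric])
    note * = quadratic_iteration[where u = ?u, OF K \<delta>(2) K\<delta> u0 this]
    have "?u k \<in> net_dom \<sigma>" for k using dom *(1) by (rule subsetD)
    then show ?thesis using *(2) by simp
  qed
  then show ?thesis using \<delta>(1) by blast
qed

end
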